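(* For every Sidon set $\mathcal{B}$ of integers and every function $\omega:(0,\infty)\to[0,\infty)$ with $\omega(x)\to\infty$ as $x\to\infty$, there exists a perfect difference set $\mathcal{A}\subseteq\mathbb{N}$ such that $$A(x)\ \ge\ B(x/3)-\omega(x)\qquad\text{for all real } x>0 .$$
   Context: $\mathbb{N}$ denotes the set of positive integers. For a set $\mathcal{A}$ of integers and an integer $u$, $d_{\mathcal{A}}(u)$ denotes the number of pairs $(a,a')\in\mathcal{A}\times\mathcal{A}$ with $u=a-a'$. The set $\mathcal{A}$ is a Sidon set if $d_{\mathcal{A}}(u)\le 1$ for all integers $u\ne 0$, and a perfect difference set if $d_{\mathcal{A}}(u)=1$ for every integer $u\neq 0$. The counting functions $A(x)$ and $B(x)$ count the positive elements not exceeding $x$ of $\mathcal{A}$ and $\mathcal{B}$, respectively. *)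

theory Defs
  imports Complex_Main "HOL-Library.Extended_Nat"
begin

text \<open>
  The number of representations is taken in \<^typ>\<open>enat\<close>, because \<^const>\<open>card\<close> is 0 on
  infinite sets: with \<^typ>\<open>nat\<close>, an integer that has infinitely many representations
  would satisfy the bound of a Sidon set.
\<close>

definition diff_rep_count :: "int set \<Rightarrow> int \<Rightarrow> enat" where
  "diff_rep_count A u =
    (let R = {(a, a'). a \<in> A \<and> a' \<in> A \<and> u = a - a'}
     in if finite R then enat (card R) else \<infinity>)"

definition sidon_set :: "int set \<Rightarrow> bool" where
  "sidon_set A \<longleftrightarrow> (\<forall>u. u \<noteq> 0 \<longrightarrow> diff_rep_count A u \<le> 1)"

definition perfect_difference_set :: "int set \<Rightarrow> bool" where
  "perfect_difference_set A \<longleftrightarrow> (\<forall>u. u \<noteq> 0 \<longrightarrow> diff_rep_count A u = 1)"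

definition counting_fun :: "int set \<Rightarrow> real \<Rightarrow> nat" where
  "counting_fun A x = card {a \<in> A. 0 < a \<and> real_of_int a \<le> x}"

end

theory Submission
  imports Defs
begin

text \<open>
  Put \<open>T = {3 * b | b \<in> B, b > 0}\<close>. This is a Sidon set of multiples of 3 with exactly
  \<open>B (x / 3)\<close> elements up to \<open>x\<close>. The set \<open>A\<close> is obtained from it by deleting few elements and by
  adding, for each integer \<open>m + 1\<close> that is still not a difference, a pair \<open>{c m, c m + m + 1}\<close>
  whose members are not divisible by 3. Every positive integer is then a difference, and the task
  is to keep the set Sidon, that is, to exclude nontrivial coincidences \<open>a + b = a' + b'\<close>.

  Modulo 3, a coincidence cannot involve exactly one added number. Each of the others is
  either removable by a deletion or impossible.

  \<^item> If two added numbers \<open>y, y'\<close> are involved, the coincidence reads \<open>t + t' = y + y'\<close> or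
    \<open>t - t' = y - y'\<close> with \<open>t, t' \<in> T\<close>. As \<open>T\<close> is Sidon, \<open>y\<close> and \<open>y'\<close> determine the larger
    element \<open>t\<close>, which is deleted.
  \<^item> If three are involved, it reads \<open>t = y + y' - y''\<close>, and \<open>t\<close> is deleted.
  \<^item> If \<open>c\<close> grows fast, the element \<open>t\<close> above is of the order of \<open>c m\<close>, where \<open>m\<close> is the largest
    index of a pair involved, unless the two members of that pair occur on opposite sides and the
    other two numbers are elements of \<open>T\<close> or of pairs with smaller index. In this case \<open>m + 1\<close>
    is the difference of these two numbers, so that the pair with index \<open>m\<close> was not added at all.
  \<^item> A nontrivial coincidence among four added numbers is of this last kind, because \<open>c\<close> grows fast.

  The deletions are made with respect to all pairs that could ever be added, so they do not depend
  on which pairs are added; that choice is a recursion over \<open>m\<close> afterwards. For each \<open>m\<close> they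
  remove \<open>O(m^3)\<close> elements, all beyond a bound \<open>L m\<close> that can be prescribed before \<open>c\<close> is
  chosen. If \<open>\<omega>\<close> exceeds the total number of deletions for indices up to \<open>m\<close> beyond \<open>L m\<close>, at most
  \<open>\<omega> x\<close> elements up to \<open>x\<close> are lost.
\<close>

section \<open>Sidon sets and sums of two elements\<close>

definition unique_sums :: "int set \<Rightarrow> bool" where
  "unique_sums A \<longleftrightarrow> (\<forall>a\<in>A. \<forall>b\<in>A. \<forall>a'\<in>A. \<forall>b'\<in>A.
     a + b = a' + b' \<longrightarrow> a = a' \<and> b = b' \<or> a = b' \<and> b = a')"

lemma unique_sumsD:
  assumes "unique_sums A" "a \<in> A" "b \<in> A" "a' \<in> A" "b' \<in> A" "a + b = a' + b'"
  shows "a = a' \<and> b = b' \<or> a = b' \<and> b = a'"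
  using assms unfolding unique_sums_def by blast

lemma unique_sums_subset: "unique_sums A \<Longrightarrow> A' \<subseteq> A \<Longrightarrow> unique_sums A'"
  unfolding unique_sums_def by (meson subsetD)

lemma diff_rep_count_le_1D:
  assumes "diff_rep_count A u \<le> 1" "a \<in> A" "a' \<in> A" "u = a - a'" "b \<in> A" "b' \<in> A" "u = b - b'"
  shows "a = b"
proof -
  define R where "R = {(a, a'). a \<in> A \<and> a' \<in> A \<and> u = a - a'}"
  have "finite R" "card R \<le> Suc 0"
    using assms(1) unfolding diff_rep_count_def R_def[symmetric]
    by (auto simp: Let_def one_enat_def split: if_splits)
  moreover have "(a, a') \<in> R" "(b, b') \<in> R"
    using assms by (auto simp: R_def)
  ultimately show ?thesis
    by (metis card_le_Suc0_iff_eq prod.inject)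
qed

lemma unique_sums_if_sidon_set:
  assumes "sidon_set A"
  shows "unique_sums A"
  unfolding unique_sums_def
proof (intro ballI impI)
  fix a b a' b' assume A: "a \<in> A" "b \<in> A" "a' \<in> A" "b' \<in> A" and eq: "a + b = a' + b'"
  show "a = a' \<and> b = b' \<or> a = b' \<and> b = a'"
  proof (cases "a = a'")
    case False
    then have "diff_rep_count A (a - a') \<le> 1"
      using assms by (simp add: sidon_set_def)
    moreover have "a - a' = b' - b" using eq by simp
    ultimately have "a = b'"
      using diff_rep_count_le_1D[OF _ A(1,3) refl A(4,2)] by blast
    then show ?thesis using eq by simp
  qed (use eq in simp)
qed

lemma perfect_difference_setI:
  assumes sums: "unique_sums A"
    and diffs: "\<And>m::nat. \<exists>a\<in>A. \<exists>a'\<in>A. a - a' = int m + 1"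
  shows "perfect_difference_set A"
  unfolding perfect_difference_set_def
proof (intro allI impI)
  fix u :: int assume u: "u \<noteq> 0"
  define R where "R = {(a, a'). a \<in> A \<and> a' \<in> A \<and> u = a - a'}"
  obtain a a' where a: "a \<in> A" "a' \<in> A" "a - a' = \<bar>u\<bar>"
    using diffs[of "nat (\<bar>u\<bar> - 1)"] u by auto
  then obtain b b' where b: "b \<in> A" "b' \<in> A" "u = b - b'"
    by (cases "u > 0") (force simp: abs_if split: if_splits)+
  have "R = {(b, b')}"
  proof -
    have "p = (b, b')" if p: "p \<in> R" for p
    proof -
      obtain d d' where d: "p = (d, d')" "d \<in> A" "d' \<in> A" "u = d - d'"
        using p by (auto simp: R_def)
      have "d + b' = b + d'" using b d by simp
      from unique_sumsD[OF sums _ _ _ _ this] show ?thesis using b d u by auto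
    qed
    moreover have "(b, b') \<in> R" using b by (simp add: R_def)
    ultimately show ?thesis by blast
  qed
  then show "diff_rep_count A u = 1"
    unfolding diff_rep_count_def R_def[symmetric] by (simp add: one_enat_def)
qed

lemma unique_sums_Un:
  assumes "unique_sums X" "unique_sums Y"
    and x3: "\<And>x x' x'' y. \<lbrakk>x \<in> X; x' \<in> X; x'' \<in> X; y \<in> Y\<rbrakk> \<Longrightarrow> x + x' \<noteq> x'' + y"
    and x2: "\<And>x x' y y'. \<lbrakk>x \<in> X; x' \<in> X; y \<in> Y; y' \<in> Y\<rbrakk> \<Longrightarrow> x + x' \<noteq> y + y'"
    and xy: "\<And>x x' y y'. \<lbrakk>x \<in> X; x' \<in> X; y \<in> Y; y' \<in> Y; x + y = x' + y'\<rbrakk> \<Longrightarrow> y = y'"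
    and y3: "\<And>x y y' y''. \<lbrakk>x \<in> X; y \<in> Y; y' \<in> Y; y'' \<in> Y\<rbrakk> \<Longrightarrow> y + y' \<noteq> y'' + x"
  shows "unique_sums (X \<union> Y)"
  unfolding unique_sums_def
proof (intro ballI impI)
  fix a b a' b' assume mem: "a \<in> X \<union> Y" "b \<in> X \<union> Y" "a' \<in> X \<union> Y" "b' \<in> X \<union> Y"
    and eq: "a + b = a' + b'"
  have eqs: "b + a = a' + b'" "a + b = b' + a'" "b + a = b' + a'"
    "a' + b' = a + b" "b' + a' = a + b" "a' + b' = b + a" "b' + a' = b + a"
    using eq by simp_all
  show "a = a' \<and> b = b' \<or> a = b' \<and> b = a'"
    using mem
  proof (elim UnE)
    assume "a \<in> X" "b \<in> X" "a' \<in> X" "b' \<in> X"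
    then show ?thesis using unique_sumsD[OF assms(1)] eq by blast
  next
    assume "a \<in> Y" "b \<in> Y" "a' \<in> Y" "b' \<in> Y"
    then show ?thesis using unique_sumsD[OF assms(2)] eq by blast
  next
    assume "a \<in> X" "b \<in> Y" "a' \<in> X" "b' \<in> Y"
    then show ?thesis using xy[of a a' b b'] eq by simp
  next
    assume "a \<in> X" "b \<in> Y" "a' \<in> Y" "b' \<in> X"
    then show ?thesis using xy[of a b' b a'] eq by simp
  next
    assume "a \<in> Y" "b \<in> X" "a' \<in> X" "b' \<in> Y"
    then show ?thesis using xy[of b a' a b'] eq by simp
  next
    assume "a \<in> Y" "b \<in> X" "a' \<in> Y" "b' \<in> X"
    then show ?thesis using xy[of b b' a a'] eq by simp
  qed (use x3[of a b a' b'] x3[of a b b' a'] x3[of a' b' a b] x3[of a' b' b a]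
        x2[of a b a' b'] x2[of a' b' a b]
        y3[of b' a b a'] y3[of a' a b b'] y3[of b a' b' a] y3[of a a' b' b] eqs eq in blast)+
qed

section \<open>Candidate pairs and deletions\<close>

text \<open>
  By \<open>c_large\<close>, half of \<open>c m\<close> and the number \<open>c m - (m + 1)\<close> are at least \<open>L m\<close>, which bounds
  the elements \<open>t\<close> in coincidences with members of the pair \<open>m\<close> alone, and in sums with one. By
  \<open>c_gap\<close>, a member of the pair \<open>m\<close> has distance more than \<open>L m\<close> from all members of earlier
  pairs and is larger than the sum of any two of them.
\<close>
locale candidate_pairs =
  fixes T :: "int set" and c L :: "nat \<Rightarrow> int"
  assumes T_unique_sums: "unique_sums T"
    and T_pos: "t \<in> T \<Longrightarrow> 0 < t"
    and T_dvd: "t \<in> T \<Longrightarrow> 3 dvd t"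
    and c_not_dvd: "\<not> 3 dvd c m" "\<not> 3 dvd c m + (int m + 1)"
    and L_nonneg: "0 \<le> L m"
    and c_large: "2 * L m + (int m + 1) \<le> c m"
    and c_gap: "j < m \<Longrightarrow> 2 * (c j + (int j + 1)) + L m + (int m + 1) < c m"
begin

definition pair :: "nat \<Rightarrow> int set" where
  "pair m = {c m, c m + (int m + 1)}"

definition pairs_upto :: "nat \<Rightarrow> int set" where
  "pairs_upto m = (\<Union>j\<le>m. pair j)"

text \<open>
  The restriction to \<open>t \<ge> L m\<close> loses nothing, because a coincidence with a smaller \<open>t\<close> turns out
  to be impossible among the pairs that are actually added; it is what keeps the deletions sparse.
\<close>
definition deleted :: "nat \<Rightarrow> int set" where
  "deleted m = {t \<in> T. L m \<le> t \<and>
     ((\<exists>y\<in>pairs_upto m. \<exists>y'\<in>pairs_upto m. \<exists>y''\<in>pairs_upto m. t = y + y' - y'') \<or>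
      (\<exists>y\<in>pairs_upto m. \<exists>y'\<in>pairs_upto m. \<exists>t'\<in>T. t' \<le> t \<and> t + t' = y + y') \<or>
      (\<exists>y\<in>pairs_upto m. \<exists>y'\<in>pairs_upto m. \<exists>t'\<in>T. y \<noteq> y' \<and> t - t' = y - y'))}"

lemma deletedI_three:
  assumes "t \<in> T" "L m \<le> t" "y \<in> pairs_upto m" "y' \<in> pairs_upto m" "y'' \<in> pairs_upto m"
    "t = y + y' - y''"
  shows "t \<in> deleted m"
proof -
  have "\<exists>y\<in>pairs_upto m. \<exists>y'\<in>pairs_upto m. \<exists>y''\<in>pairs_upto m. t = y + y' - y''"
    using assms(3-6) by (intro bexI)
  then show ?thesis using assms(1,2) by (simp add: deleted_def)
qed

lemma deletedI_sum:
  assumes "t \<in> T" "L m \<le> t" "y \<in> pairs_upto m" "y' \<in> pairs_upto m" "t' \<in> T" "t' \<le> t"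
    "t + t' = y + y'"
  shows "t \<in> deleted m"
proof -
  have "\<exists>y\<in>pairs_upto m. \<exists>y'\<in>pairs_upto m. \<exists>t'\<in>T. t' \<le> t \<and> t + t' = y + y'"
    using assms(3-7) by (intro bexI conjI)
  then show ?thesis using assms(1,2) by (simp add: deleted_def)
qed

lemma deletedI_diff:
  assumes "t \<in> T" "L m \<le> t" "y \<in> pairs_upto m" "y' \<in> pairs_upto m" "t' \<in> T" "y \<noteq> y'"
    "t - t' = y - y'"
  shows "t \<in> deleted m"
proof -
  have "\<exists>y\<in>pairs_upto m. \<exists>y'\<in>pairs_upto m. \<exists>t'\<in>T. y \<noteq> y' \<and> t - t' = y - y'"
    using assms(3-7) by (intro bexI conjI)
  then show ?thesis using assms(1,2) by (simp add: deleted_def)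
qed

definition kept :: "int set" where
  "kept = T - (\<Union>m. deleted m)"

lemma keptD: "t \<in> kept \<Longrightarrow> t \<in> T" "t \<in> kept \<Longrightarrow> t \<notin> deleted m"
  by (auto simp: kept_def)

lemma pair_subset_pairs_upto: "y \<in> pair j \<Longrightarrow> j \<le> m \<Longrightarrow> y \<in> pairs_upto m"
  by (auto simp: pairs_upto_def)

lemma pair_bounds: "y \<in> pair m \<Longrightarrow> c m \<le> y \<and> y \<le> c m + (int m + 1)"
  by (auto simp: pair_def)

lemma pair_not_dvd: "y \<in> pair m \<Longrightarrow> \<not> 3 dvd y"
  using c_not_dvd by (auto simp: pair_def)

lemma pair_pos: "y \<in> pair m \<Longrightarrow> 0 < y"
  using pair_bounds[of y m] c_large[of m] L_nonneg[of m] by linarith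

lemma pair_gap:
  assumes "y \<in> pair j" "z \<in> pair m" "j < m"
  shows "2 * y + L m + (int m + 1) < z"
proof -
  have "y \<le> c j + (int j + 1)" "c m \<le> z" using pair_bounds assms by blast+
  then show ?thesis using c_gap[OF assms(3)] by (simp add: algebra_simps)
qed

lemma pair_diff: "y \<in> pair m \<Longrightarrow> z \<in> pair m \<Longrightarrow> y = z \<or> y - z = int m + 1 \<or> z - y = int m + 1"
  by (auto simp: pair_def)

text \<open>
  The sum (or the nonzero difference) of two candidates determines the deleted element, since \<open>T\<close>
  is a Sidon set. Hence the deleted elements are values of functions on tuples of candidates.
\<close>
lemma deleted_finite_card:
  "finite (deleted m) \<and> card (deleted m) \<le> 3 * (2 * Suc m) ^ 3"
proof -
  let ?F = "pairs_upto m" and ?q = "2 * Suc m"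
  define by_sum where "by_sum = (\<lambda>(y, y'). THE t. t \<in> T \<and> (\<exists>t'\<in>T. t' \<le> t \<and> t + t' = y + y'))"
  define by_diff where "by_diff = (\<lambda>(y, y'). THE t. t \<in> T \<and> (\<exists>t'\<in>T. t - t' = y - y'))"
  define by_three where "by_three = (\<lambda>(y, y', y''). y + y' - y'' :: int)"
  have fin: "finite ?F"
    by (auto simp: pairs_upto_def pair_def)
  have "card ?F \<le> (\<Sum>j\<le>m. card (pair j))"
    unfolding pairs_upto_def by (rule card_UN_le) simp
  also have "\<dots> \<le> (\<Sum>j\<le>m. 2)"
    by (intro sum_mono) (simp add: pair_def card_insert_if)
  finally have card_F: "card ?F \<le> ?q" by simp
  have sum_eq: "by_sum (y, y') = t"
    if "t \<in> T" "t' \<in> T" "t' \<le> t" "t + t' = y + y'" for t t' y y'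
    unfolding by_sum_def prod.case
  proof (rule the_equality)
    fix s assume "s \<in> T \<and> (\<exists>s'\<in>T. s' \<le> s \<and> s + s' = y + y')"
    then obtain s' where s: "s \<in> T" "s' \<in> T" "s' \<le> s" "s + s' = t + t'"
      unfolding \<open>t + t' = y + y'\<close> by blast
    from unique_sumsD[OF T_unique_sums s(1,2) that(1,2) s(4)] show "s = t"
      using s that by auto
  qed (use that in blast)
  have diff_eq: "by_diff (y, y') = t"
    if "t \<in> T" "t' \<in> T" "y \<noteq> y'" "t - t' = y - y'" for t t' y y'
    unfolding by_diff_def prod.case
  proof (rule the_equality)
    fix s assume "s \<in> T \<and> (\<exists>s'\<in>T. s - s' = y - y')"
    then obtain s' where s: "s \<in> T" "s' \<in> T" and "s - s' = t - t'"
      unfolding \<open>t - t' = y - y'\<close> by blast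
    then have eq: "s + t' = t + s'" by linarith
    from unique_sumsD[OF T_unique_sums s(1) that(2,1) s(2) eq] show "s = t"
      using s that by auto
  qed (use that in blast)
  have sub: "deleted m \<subseteq> by_three ` (?F \<times> ?F \<times> ?F) \<union> by_sum ` (?F \<times> ?F) \<union> by_diff ` (?F \<times> ?F)"
    (is "_ \<subseteq> ?U1 \<union> ?U2 \<union> ?U3")
  proof
    fix t assume t: "t \<in> deleted m"
    then have "t \<in> T" by (simp add: deleted_def)
    from t consider
        (three) y y' y'' where "y \<in> ?F" "y' \<in> ?F" "y'' \<in> ?F" "t = y + y' - y''"
      | (sum) y y' t' where "y \<in> ?F" "y' \<in> ?F" "t' \<in> T" "t' \<le> t" "t + t' = y + y'"
      | (diff) y y' t' where "y \<in> ?F" "y' \<in> ?F" "t' \<in> T" "y \<noteq> y'" "t - t' = y - y'"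
      unfolding deleted_def by blast
    then show "t \<in> ?U1 \<union> ?U2 \<union> ?U3"
    proof cases
      case three
      then have "t = by_three (y, y', y'')" by (simp add: by_three_def)
      then show ?thesis using three by blast
    next
      case sum
      then have "t = by_sum (y, y')" using sum_eq \<open>t \<in> T\<close> by simp
      then show ?thesis using sum by blast
    next
      case diff
      then have "t = by_diff (y, y')" using diff_eq \<open>t \<in> T\<close> by simp
      then show ?thesis using diff by blast
    qed
  qed
  have finU: "finite (?U1 \<union> ?U2 \<union> ?U3)" using fin by simp
  have q2: "card (?F \<times> ?F) \<le> ?q ^ 2"
    unfolding card_cartesian_product power2_eq_square using card_F by (intro mult_mono) auto
  have q3: "card (?F \<times> ?F \<times> ?F) \<le> ?q ^ 3"
  proof -
    have "card (?F \<times> ?F \<times> ?F) \<le> ?q * ?q ^ 2"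
      unfolding card_cartesian_product[of ?F "?F \<times> ?F"] using card_F q2 by (intro mult_mono) auto
    then show ?thesis by (simp only: power3_eq_cube power2_eq_square mult.assoc)
  qed
  have q23: "?q ^ 2 \<le> ?q ^ 3" by (rule power_increasing) auto
  have "card ?U1 \<le> ?q ^ 3"
    using card_image_le[of "?F \<times> ?F \<times> ?F" by_three] fin q3 by simp
  moreover have "card ?U2 \<le> ?q ^ 3" "card ?U3 \<le> ?q ^ 3"
    using card_image_le[OF finite_cartesian_product[OF fin fin], of by_sum]
      card_image_le[OF finite_cartesian_product[OF fin fin], of by_diff] q2 q23
    by linarith+
  ultimately have "card (?U1 \<union> ?U2 \<union> ?U3) \<le> 3 * ?q ^ 3"
    using card_Un_le[of "?U1 \<union> ?U2" ?U3] card_Un_le[of ?U1 ?U2] by linarith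
  then show ?thesis
    using card_mono[OF finU sub] finite_subset[OF sub finU] by simp
qed

section \<open>Adding the pairs that are needed\<close>

text \<open>
  The elements available before the pair \<open>m\<close> is considered, if \<open>I\<close> is the set of indices of the
  pairs that are added.
\<close>
definition stage :: "nat set \<Rightarrow> nat \<Rightarrow> int set" where
  "stage I m = kept \<union> (\<Union>j\<in>{j \<in> I. j < m}. pair j)"

text \<open>The condition on \<open>m\<close> only depends on the indices below \<open>m\<close>, so it is a recursive definition.\<close>
lemma greedy_choice_exists:
  "\<exists>I. \<forall>m. m \<in> I \<longleftrightarrow> (\<forall>a\<in>stage I m. \<forall>a'\<in>stage I m. a - a' \<noteq> int m + 1)"
proof -
  have stage_cong: "stage {j. f j} m = stage {j. g j} m" if "\<And>j. j < m \<Longrightarrow> f j = g j" for f g m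
    unfolding stage_def using that by (intro arg_cong2[of _ _ _ _ "(\<union>)"]) auto
  have "\<exists>f. \<forall>m. f m \<longleftrightarrow> (\<forall>a\<in>stage {j. f j} m. \<forall>a'\<in>stage {j. f j} m. a - a' \<noteq> int m + 1)"
  proof (rule dependent_wellorder_choice)
    fix r and f g :: "nat \<Rightarrow> bool" and m :: nat
    assume "\<And>j. j < m \<Longrightarrow> f j = g j"
    from stage_cong[OF this]
    show "(r \<longleftrightarrow> (\<forall>a\<in>stage {j. f j} m. \<forall>a'\<in>stage {j. f j} m. a - a' \<noteq> int m + 1)) \<longleftrightarrow>
          (r \<longleftrightarrow> (\<forall>a\<in>stage {j. g j} m. \<forall>a'\<in>stage {j. g j} m. a - a' \<noteq> int m + 1))"
      by simp
  qed blast
  then obtain f where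
    "\<forall>m. f m \<longleftrightarrow> (\<forall>a\<in>stage {j. f j} m. \<forall>a'\<in>stage {j. f j} m. a - a' \<noteq> int m + 1)" ..
  then have "\<forall>m. m \<in> {j. f j} \<longleftrightarrow>
    (\<forall>a\<in>stage {j. f j} m. \<forall>a'\<in>stage {j. f j} m. a - a' \<noteq> int m + 1)"
    unfolding mem_Collect_eq .
  then show ?thesis ..
qed

end

locale greedy_pairs = candidate_pairs +
  fixes I :: "nat set"
  assumes greedy: "m \<in> I \<longleftrightarrow> (\<forall>a\<in>stage I m. \<forall>a'\<in>stage I m. a - a' \<noteq> int m + 1)"
begin

definition added :: "int set" where
  "added = (\<Union>m\<in>I. pair m)"

lemma not_earlier_difference:
  "m \<in> I \<Longrightarrow> a \<in> stage I m \<Longrightarrow> a' \<in> stage I m \<Longrightarrow> a - a' \<noteq> int m + 1"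
  using greedy by blast

lemma stageI: "t \<in> kept \<Longrightarrow> t \<in> stage I m" "y \<in> pair j \<Longrightarrow> j \<in> I \<Longrightarrow> j < m \<Longrightarrow> y \<in> stage I m"
  by (auto simp: stage_def)

lemma addedE:
  assumes "y \<in> added"
  obtains j where "j \<in> I" "y \<in> pair j"
  using assms by (auto simp: added_def)

text \<open>
  If \<open>y1 \<noteq> y3\<close>, then \<open>y2\<close> and \<open>y4\<close> differ by \<open>m + 1\<close>. This is less than the gap between pairs,
  so it cannot happen if just one of them belongs to the pair \<open>m\<close>; the greedy choice excludes it
  if both have smaller index.
\<close>
lemma added_sum_top_opposite:
  assumes "m \<in> I" "y1 \<in> pair m" "y3 \<in> pair m" "i \<in> I" "i \<le> m" "y2 \<in> pair i"
    "j \<in> I" "j \<le> m" "y4 \<in> pair j" "y1 + y2 = y3 + y4"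
  shows "y1 = y3 \<and> y2 = y4 \<or> y1 = y4 \<and> y2 = y3"
proof (cases "y1 = y3")
  case False
  then have d: "y1 - y3 = int m + 1 \<or> y3 - y1 = int m + 1" using pair_diff assms by blast
  consider "i = m" "j = m" | "i = m" "j < m" | "i < m" "j = m" | "i < m" "j < m"
    using assms by linarith
  then show ?thesis
  proof cases
    case 1
    then show ?thesis using assms False by (auto simp: pair_def)
  next
    case 2
    then show ?thesis
      using assms d pair_gap[of y4 j y2 m] pair_pos[of y4 j] L_nonneg[of m] by auto
  next
    case 3
    then show ?thesis
      using assms d pair_gap[of y2 i y4 m] pair_pos[of y2 i] L_nonneg[of m] by auto
  next
    case 4
    then have "y2 \<in> stage I m" "y4 \<in> stage I m" using assms stageI by auto
    then have "y2 - y4 \<noteq> int m + 1" "y4 - y2 \<noteq> int m + 1"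
      using not_earlier_difference assms(1) by blast+
    then show ?thesis using d assms(10) by linarith
  qed
qed (use assms in simp)

lemma added_sum_top:
  assumes "m \<in> I" "y1 \<in> pair m" "i \<in> I" "i \<le> m" "y2 \<in> pair i"
    "j \<in> I" "j \<le> m" "y3 \<in> pair j" "k \<in> I" "k \<le> m" "y4 \<in> pair k" "y1 + y2 = y3 + y4"
  shows "y1 = y3 \<and> y2 = y4 \<or> y1 = y4 \<and> y2 = y3"
proof -
  consider "j = m" | "k = m" | "j < m" "k < m" using assms by linarith
  then show ?thesis
  proof cases
    case 1
    then show ?thesis using added_sum_top_opposite[of m y1 y3 i y2 k y4] assms by blast
  next
    case 2
    then show ?thesis using added_sum_top_opposite[of m y1 y4 i y2 j y3] assms by auto
  next
    case 3
    then show ?thesis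
      using pair_gap[of y3 j y1 m] pair_gap[of y4 k y1 m] pair_pos[of y2 i] L_nonneg[of m] assms
      by linarith
  qed
qed

lemma added_unique_sums: "unique_sums added"
  unfolding unique_sums_def
proof (intro ballI impI)
  fix y1 y2 y3 y4
  assume "y1 \<in> added" "y2 \<in> added" "y3 \<in> added" "y4 \<in> added" and eq: "y1 + y2 = y3 + y4"
  then obtain i1 i2 i3 i4 where y: "i1 \<in> I" "y1 \<in> pair i1" "i2 \<in> I" "y2 \<in> pair i2"
    "i3 \<in> I" "y3 \<in> pair i3" "i4 \<in> I" "y4 \<in> pair i4"
    by (metis addedE)
  consider "i2 \<le> i1" "i3 \<le> i1" "i4 \<le> i1" | "i1 \<le> i2" "i3 \<le> i2" "i4 \<le> i2"
    | "i1 \<le> i3" "i2 \<le> i3" "i4 \<le> i3" | "i1 \<le> i4" "i2 \<le> i4" "i3 \<le> i4" by linarith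
  then show "y1 = y3 \<and> y2 = y4 \<or> y1 = y4 \<and> y2 = y3"
  proof cases
    case 1
    then show ?thesis using added_sum_top[of i1 y1 i2 y2 i3 y3 i4 y4] y eq by blast
  next
    case 2
    then show ?thesis using added_sum_top[of i2 y2 i1 y1 i3 y3 i4 y4] y eq by auto
  next
    case 3
    then show ?thesis using added_sum_top[of i3 y3 i4 y4 i1 y1 i2 y2] y eq by auto
  next
    case 4
    then show ?thesis using added_sum_top[of i4 y4 i3 y3 i1 y1 i2 y2] y eq by auto
  qed
qed

text \<open>The larger of \<open>t\<close> and \<open>t'\<close> is at least half of the sum, hence large enough to be deleted.\<close>
lemma kept_sum_ne_added_sum:
  assumes t: "t \<in> kept" "t' \<in> kept" and y: "y \<in> pair i" "y' \<in> pair j"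
  shows "t + t' \<noteq> y + y'"
proof
  assume eq: "t + t' = y + y'"
  define m where "m = max i j"
  have F: "y \<in> pairs_upto m" "y' \<in> pairs_upto m"
    using y pair_subset_pairs_upto by (auto simp: m_def)
  have "2 * L m \<le> y + y'"
  proof (cases "i \<le> j")
    case True
    then show ?thesis
      using c_large[of m] pair_bounds[OF y(2)] pair_pos[OF y(1)] by (simp add: m_def)
  next
    case False
    then show ?thesis
      using c_large[of m] pair_bounds[OF y(1)] pair_pos[OF y(2)] by (simp add: m_def)
  qed
  then have L: "2 * L m \<le> t + t'" using eq by simp
  show False
  proof (cases "t' \<le> t")
    case True
    then have "L m \<le> t" using L by linarith
    then have "t \<in> deleted m"
      using deletedI_sum[OF _ _ F _ True eq] t[THEN keptD(1)] by blast
    then show False using keptD(2) t by blast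
  next
    case False
    then have L': "L m \<le> t'" "t \<le> t'" "t' + t = y + y'" using L eq by linarith+
    then have "t' \<in> deleted m"
      using deletedI_sum[OF _ L'(1) F _ L'(2,3)] t[THEN keptD(1)] by blast
    then show False using keptD(2) t by blast
  qed
qed

text \<open>
  The larger element \<open>t\<close> exceeds \<open>y - y'\<close>, hence \<open>L m\<close>, because all elements of \<open>T\<close> are positive.
\<close>
lemma kept_diff_ne_pair_diff:
  assumes t: "t \<in> kept" "t' \<in> kept" and y: "y \<in> pair m" "y' \<in> pair i" and "i < m"
  shows "t - t' \<noteq> y - y'"
proof
  assume eq: "t - t' = y - y'"
  have gap: "2 * y' + L m + (int m + 1) < y" using pair_gap y \<open>i < m\<close> by blast
  have "L m \<le> t" "y \<noteq> y'"
    using gap eq T_pos[OF keptD(1)[OF t(2)]] pair_pos[OF y(2)] L_nonneg[of m] by linarith+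
  moreover have "y \<in> pairs_upto m" "y' \<in> pairs_upto m"
    using y pair_subset_pairs_upto \<open>i < m\<close> by auto
  ultimately have "t \<in> deleted m"
    using deletedI_diff[OF _ _ _ _ _ _ eq] t[THEN keptD(1)] by blast
  then show False using keptD(2) t by blast
qed

text \<open>
  Two members of one pair may have the same difference as two small elements of \<open>T\<close>, which are
  not deleted; it is the greedy choice that excludes this.
\<close>
lemma kept_added_cancel:
  assumes t: "t \<in> kept" "t' \<in> kept" and y: "y \<in> added" "y' \<in> added" and eq: "t + y = t' + y'"
  shows "y = y'"
proof -
  obtain i j where ij: "i \<in> I" "y \<in> pair i" "j \<in> I" "y' \<in> pair j" using y by (metis addedE)
  consider "i < j" | "j < i" | "i = j" by linarith
  then show ?thesis
  proof cases
    case 1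
    then show ?thesis using kept_diff_ne_pair_diff[OF t ij(4,2)] eq by simp
  next
    case 2
    then show ?thesis using kept_diff_ne_pair_diff[OF t(2,1) ij(2,4)] eq by simp
  next
    case 3
    have "t - t' \<noteq> int i + 1" "t' - t \<noteq> int i + 1"
      using not_earlier_difference[OF ij(1)] stageI(1) t by blast+
    then show ?thesis using pair_diff[of y i y'] 3 ij eq by auto
  qed
qed

text \<open>
  Either \<open>y''\<close> has a smaller index than \<open>y\<close>, or all three have the same index, and then \<open>t\<close> is so
  large that it was deleted; or \<open>y\<close> and \<open>y''\<close> are the two members of the pair \<open>m\<close>, and then \<open>m + 1\<close>
  is the difference of \<open>t\<close> and \<open>y'\<close>, which contradicts the greedy choice. The case \<open>y = y''\<close>
  is excluded modulo 3.
\<close>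
lemma kept_ne_three_added_top:
  assumes t: "t \<in> kept" and m: "m \<in> I" "y \<in> pair m"
    and j: "j \<in> I" "j \<le> m" "y' \<in> pair j" and k: "k \<le> m" "y'' \<in> pair k"
  shows "y + y' \<noteq> y'' + t"
proof
  assume eq: "y + y' = y'' + t"
  have small: "\<not> L m \<le> t"
  proof
    assume "L m \<le> t"
    moreover have "t = y + y' - y''" using eq by simp
    moreover have "y \<in> pairs_upto m" "y' \<in> pairs_upto m" "y'' \<in> pairs_upto m"
      using m j k pair_subset_pairs_upto by blast+
    ultimately have "t \<in> deleted m"
      using deletedI_three keptD(1)[OF t] by blast
    then show False using keptD(2) t by blast
  qed
  consider "k < m" | "k = m" "j = m" | "k = m" "j < m" using j k by linarith
  then show False
  proof cases
    case 1
    then show False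
      using small pair_gap[of y'' k y m] m k pair_pos[OF k(2)] pair_pos[OF j(3)] eq by linarith
  next
    case 2
    then have "c m - (int m + 1) \<le> t"
      using eq pair_bounds[OF m(2)] pair_bounds[OF j(3)] pair_bounds[OF k(2)] by simp
    then show False using small c_large[of m] L_nonneg[of m] by linarith
  next
    case 3
    have "y \<noteq> y''"
    proof
      assume "y = y''"
      then have "y' = t" using eq by simp
      then show False using T_dvd[OF keptD(1)[OF t]] pair_not_dvd[OF j(3)] by simp
    qed
    moreover have "t - y' \<noteq> int m + 1" "y' - t \<noteq> int m + 1"
      using not_earlier_difference[OF m(1)] stageI(1)[OF t] stageI(2)[OF j(3,1) 3(2)] by blast+
    ultimately show False using pair_diff[of y m y''] m k 3 eq by auto
  qed
qed

lemma kept_ne_three_added: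
  assumes t: "t \<in> kept" and y: "y \<in> added" "y' \<in> added" "y'' \<in> added"
  shows "y + y' \<noteq> y'' + t"
proof -
  obtain i j k where ijk: "i \<in> I" "y \<in> pair i" "j \<in> I" "y' \<in> pair j" "k \<in> I" "y'' \<in> pair k"
    using y by (metis addedE)
  consider "j \<le> i" "k \<le> i" | "i \<le> j" "k \<le> j" | "i < k" "j < k" by linarith
  then show ?thesis
  proof cases
    case 1
    then show ?thesis using kept_ne_three_added_top[OF t] ijk by blast
  next
    case 2
    then show ?thesis using kept_ne_three_added_top[OF t ijk(3,4,1) _ ijk(2) _ ijk(6)] by simp
  next
    case 3
    then show ?thesis
      using pair_gap[of y i y'' k] pair_gap[of y' j y'' k] ijk T_pos[OF keptD(1)[OF t]] L_nonneg[of k]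
      by linarith
  qed
qed

lemma unique_sums_result: "unique_sums (kept \<union> added)"
proof (rule unique_sums_Un)
  show "unique_sums kept"
    using T_unique_sums by (rule unique_sums_subset) (auto simp: kept_def)
next
  fix t t' t'' y assume "t \<in> kept" "t' \<in> kept" "t'' \<in> kept" "y \<in> added"
  then have d: "3 dvd t" "3 dvd t'" "3 dvd t''" "\<not> 3 dvd y"
    using T_dvd keptD(1) pair_not_dvd by (auto elim: addedE)
  show "t + t' \<noteq> t'' + y"
  proof
    assume "t + t' = t'' + y"
    then have "y = t + t' - t''" by simp
    then show False using d by simp
  qed
next
  fix t t' y y' assume "t \<in> kept" "t' \<in> kept" "y \<in> added" "y' \<in> added"
  then show "t + t' \<noteq> y + y'" using kept_sum_ne_added_sum by (metis addedE)
qed (use added_unique_sums kept_added_cancel kept_ne_three_added in blast)+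

lemma perfect_difference_set_result: "perfect_difference_set (kept \<union> added)"
proof (rule perfect_difference_setI[OF unique_sums_result])
  fix m :: nat
  show "\<exists>a\<in>kept \<union> added. \<exists>a'\<in>kept \<union> added. a - a' = int m + 1"
  proof (cases "m \<in> I")
    case True
    then have "c m \<in> added" "c m + (int m + 1) \<in> added" by (auto simp: added_def pair_def)
    then show ?thesis by (metis UnCI add_diff_cancel_left')
  next
    case False
    moreover have "stage I m \<subseteq> kept \<union> added" by (auto simp: stage_def added_def)
    ultimately show ?thesis using greedy by blast
  qed
qed

lemma result_pos: "kept \<union> added \<subseteq> {0<..}"
  using T_pos keptD(1) pair_pos by (auto elim: addedE)

end

section \<open>Counting and the choice of the parameters\<close>

lemma finite_ints_between: "finite {a \<in> A. 0 < a \<and> real_of_int a \<le> x}"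
  by (rule finite_subset[of _ "{0..\<lfloor>x\<rfloor>}"]) (auto simp: le_floor_iff)

lemma counting_fun_triple:
  "counting_fun ((*) 3 ` {b \<in> B. 0 < b}) x = counting_fun B (x / 3)"
proof -
  have "{a \<in> (*) 3 ` {b \<in> B. 0 < b}. 0 < a \<and> real_of_int a \<le> x}
      = (*) 3 ` {b \<in> B. 0 < b \<and> real_of_int b \<le> x / 3}"
    by (auto simp: field_simps)
  then show ?thesis
    unfolding counting_fun_def by (simp add: card_image inj_on_def)
qed

lemma counting_fun_le_Un:
  assumes "A \<subseteq> A' \<union> D"
  shows "counting_fun A x \<le> counting_fun A' x + counting_fun D x"
proof -
  have "counting_fun A x \<le> card ({a \<in> A'. 0 < a \<and> real_of_int a \<le> x} \<union> {a \<in> D. 0 < a \<and> real_of_int a \<le> x})"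
    unfolding counting_fun_def using assms by (intro card_mono) (auto intro: finite_ints_between)
  then show ?thesis
    unfolding counting_fun_def using card_Un_le le_trans by blast
qed

text \<open>
  An element up to \<open>x\<close> can only lie in some \<open>D m\<close> with \<open>L m \<le> x\<close>; if \<open>M\<close> is the largest
  such \<open>m\<close>, then \<open>\<omega> x\<close> already exceeds the number of elements of all \<open>D m\<close> with \<open>m \<le> M\<close>.
\<close>
lemma counting_fun_sparse_union:
  fixes D :: "nat \<Rightarrow> int set" and L :: "nat \<Rightarrow> int" and N :: "nat \<Rightarrow> nat"
  assumes D: "\<And>m. finite (D m)" "\<And>m. card (D m) \<le> N m"
    and D_ge: "\<And>m t. t \<in> D m \<Longrightarrow> L m \<le> t"
    and L: "\<And>m. int m \<le> L m"
    and \<omega>: "\<And>m x. real_of_int (L m) \<le> x \<Longrightarrow> real (\<Sum>j\<le>m. N j) \<le> \<omega> x"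
    and "0 \<le> \<omega> x"
  shows "real (counting_fun (\<Union>m. D m) x) \<le> \<omega> x"
proof -
  define J where "J = {m. real_of_int (L m) \<le> x}"
  define X where "X = {t \<in> (\<Union>m. D m). 0 < t \<and> real_of_int t \<le> x}"
  have "J \<subseteq> {..nat \<lfloor>x\<rfloor>}"
  proof
    fix m assume "m \<in> J"
    then have "real_of_int (L m) \<le> x" by (simp add: J_def)
    then have "real m \<le> x" using L[of m] by linarith
    then show "m \<in> {..nat \<lfloor>x\<rfloor>}" by (simp add: le_nat_floor)
  qed
  then have finJ: "finite J" by (rule finite_subset) simp
  have XJ: "X \<subseteq> (\<Union>m\<in>J. D m)"
  proof
    fix t assume "t \<in> X"
    then obtain m where m: "t \<in> D m" "real_of_int t \<le> x" by (auto simp: X_def)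
    then have "real_of_int (L m) \<le> x" using D_ge[of t m] by linarith
    then have "m \<in> J" by (simp add: J_def)
    then show "t \<in> (\<Union>m\<in>J. D m)" using m by blast
  qed
  show ?thesis
  proof (cases "J = {}")
    case True
    then have "counting_fun (\<Union>m. D m) x = 0"
      using XJ unfolding counting_fun_def X_def[symmetric] by simp
    then show ?thesis using \<open>0 \<le> \<omega> x\<close> by simp
  next
    case False
    define M where "M = Max J"
    have "M \<in> J" using finJ False by (simp add: M_def)
    have "J \<subseteq> {..M}" using finJ by (auto simp: M_def)
    then have "X \<subseteq> (\<Union>m\<le>M. D m)" using XJ by blast
    then have "card X \<le> card (\<Union>m\<le>M. D m)" using D(1) by (intro card_mono) auto
    also have "\<dots> \<le> (\<Sum>m\<le>M. card (D m))" by (rule card_UN_le) simp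
    also have "\<dots> \<le> (\<Sum>m\<le>M. N m)" using D(2) by (rule sum_mono)
    finally have "real (card X) \<le> real (\<Sum>m\<le>M. N m)" by (rule of_nat_mono)
    also have "\<dots> \<le> \<omega> x" using \<omega> \<open>M \<in> J\<close> by (simp add: J_def)
    finally show ?thesis by (simp add: counting_fun_def X_def)
  qed
qed

lemma thresholds_exist:
  fixes \<omega> :: "real \<Rightarrow> real" and G :: "nat \<Rightarrow> real"
  assumes "filterlim \<omega> at_top at_top"
  shows "\<exists>L :: nat \<Rightarrow> int. \<forall>m. int m \<le> L m \<and> (\<forall>x\<ge>real_of_int (L m). G m \<le> \<omega> x)"
proof (intro choice allI)
  fix m
  have "eventually (\<lambda>x. G m \<le> \<omega> x) at_top"
    using assms by (simp add: filterlim_at_top)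
  then obtain X where X: "\<And>x. X \<le> x \<Longrightarrow> G m \<le> \<omega> x"
    by (auto simp: eventually_at_top_linorder)
  show "\<exists>L::int. int m \<le> L \<and> (\<forall>x\<ge>real_of_int L. G m \<le> \<omega> x)"
  proof (intro exI[of _ "max (int m) \<lceil>X\<rceil>"] conjI allI impI)
    fix x assume "real_of_int (max (int m) \<lceil>X\<rceil>) \<le> x"
    then have "X \<le> x" by linarith
    then show "G m \<le> \<omega> x" by (rule X)
  qed simp
qed

lemma pair_positions_exist:
  fixes L :: "nat \<Rightarrow> int"
  shows "\<exists>c :: nat \<Rightarrow> int. \<forall>m. \<not> 3 dvd c m \<and> \<not> 3 dvd c m + (int m + 1) \<and>
    2 * L m + (int m + 1) \<le> c m \<and>
    (\<forall>j<m. 2 * (c j + (int j + 1)) + L m + (int m + 1) < c m)"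
proof (rule dependent_wellorder_choice)
  fix m :: nat and c :: "nat \<Rightarrow> int"
  define X where "X = insert (2 * L m + (int m + 1))
    ((\<lambda>j. 2 * (c j + (int j + 1)) + L m + (int m + 1)) ` {..<m})"
  define K where "K = max 0 (Max X)"
  have "finite X" by (simp add: X_def)
  then have K: "z \<le> K" if "z \<in> X" for z
    using that by (simp add: K_def le_max_iff_disj)
  \<comment> \<open>A residue modulo 3 that is neither 0 nor that of \<open>- (m + 1)\<close>.\<close>
  define r where "r = (if (int m + 1) mod 3 = 2 then 2 else 1 :: int)"
  have dvd: "\<not> 3 dvd 3 * K + r \<and> \<not> 3 dvd 3 * K + r + (int m + 1)"
    unfolding r_def by presburger
  have "0 \<le> K" by (simp add: K_def)
  then have K_less: "K < 3 * K + r" by (simp add: r_def)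
  show "\<exists>r. \<not> 3 dvd r \<and> \<not> 3 dvd r + (int m + 1) \<and> 2 * L m + (int m + 1) \<le> r \<and>
    (\<forall>j<m. 2 * (c j + (int j + 1)) + L m + (int m + 1) < r)"
  proof (intro exI[of _ "3 * K + r"] conjI allI impI)
    show "2 * L m + (int m + 1) \<le> 3 * K + r"
      using K[of "2 * L m + (int m + 1)"] K_less by (simp add: X_def)
    show "2 * (c j + (int j + 1)) + L m + (int m + 1) < 3 * K + r" if "j < m" for j
      using K[of "2 * (c j + (int j + 1)) + L m + (int m + 1)"] K_less that by (simp add: X_def)
  qed (use dvd in blast)+
qed simp

theorem theorem1:
  fixes B :: "int set" and \<omega> :: "real \<Rightarrow> real"
  assumes "sidon_set B"
    and "\<forall>x>0. 0 \<le> \<omega> x"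
    and "filterlim \<omega> at_top at_top"
  shows "\<exists>A :: int set. A \<subseteq> {0<..} \<and> perfect_difference_set A \<and>
           (\<forall>x>0. real (counting_fun A x) \<ge> real (counting_fun B (x / 3)) - \<omega> x)"
proof -
  define T where "T = (*) 3 ` {b \<in> B. 0 < b}"
  define N :: "nat \<Rightarrow> nat" where "N m = 3 * (2 * Suc m) ^ 3" for m
  obtain L :: "nat \<Rightarrow> int" where L: "\<And>m. int m \<le> L m"
    "\<And>m x. real_of_int (L m) \<le> x \<Longrightarrow> real (\<Sum>j\<le>m. N j) \<le> \<omega> x"
    using thresholds_exist[OF assms(3), of "\<lambda>m. real (\<Sum>j\<le>m. N j)"] by blast
  obtain c :: "nat \<Rightarrow> int" where c: "\<And>m. \<not> 3 dvd c m" "\<And>m. \<not> 3 dvd c m + (int m + 1)"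
    "\<And>m. 2 * L m + (int m + 1) \<le> c m"
    "\<And>m j. j < m \<Longrightarrow> 2 * (c j + (int j + 1)) + L m + (int m + 1) < c m"
    using pair_positions_exist[of L] by blast
  have "unique_sums T"
    unfolding unique_sums_def
  proof (intro ballI impI)
    fix a b a' b' assume "a \<in> T" "b \<in> T" "a' \<in> T" "b' \<in> T" and eq: "a + b = a' + b'"
    then obtain p q p' q' where B: "p \<in> B" "q \<in> B" "p' \<in> B" "q' \<in> B"
      and T: "a = 3 * p" "b = 3 * q" "a' = 3 * p'" "b' = 3 * q'"
      by (auto simp: T_def)
    have "p + q = p' + q'" using eq T by simp
    from unique_sumsD[OF unique_sums_if_sidon_set[OF assms(1)] B this]
    show "a = a' \<and> b = b' \<or> a = b' \<and> b = a'"
      using T by auto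
  qed
  interpret candidate_pairs T c L
  proof
    show "unique_sums T" by fact
    show "0 \<le> L m" for m using L(1)[of m] by linarith
  qed (use c in \<open>auto simp: T_def\<close>)
  obtain I where "\<And>m. m \<in> I \<longleftrightarrow> (\<forall>a\<in>stage I m. \<forall>a'\<in>stage I m. a - a' \<noteq> int m + 1)"
    using greedy_choice_exists by blast
  then interpret greedy_pairs T c L I
    by unfold_locales
  have "real (counting_fun B (x / 3)) - \<omega> x \<le> real (counting_fun (kept \<union> added) x)"
    if "x > 0" for x
  proof -
    have "counting_fun T x \<le> counting_fun (kept \<union> added) x + counting_fun (\<Union>m. deleted m) x"
      by (rule counting_fun_le_Un) (auto simp: kept_def)
    moreover have "real (counting_fun (\<Union>m. deleted m) x) \<le> \<omega> x"
    proof (rule counting_fun_sparse_union[where L = L and N = N])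
      show "L m \<le> t" if "t \<in> deleted m" for m t using that by (simp add: deleted_def)
    qed (use deleted_finite_card L assms(2) that in \<open>auto simp: N_def\<close>)
    ultimately show ?thesis
      using counting_fun_triple[of B x] by (simp add: T_def)
  qed
  then show ?thesis
    using perfect_difference_set_result result_pos by blast
qed

end
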